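(* Let $k\in\mathbb{N}$, let $a_1>a_2>\ldots>a_k>0$ be real numbers, and let $m(n)=a_1^n+a_2^n+\ldots+a_k^n$ for $n\in\mathbb{N}_0$. Then the sequence $m=(m(n))_{n\ge0}$ preserves summability.
   Context: Let $\mathbb{E}$ be a complex Banach space with norm $\|\cdot\|_{\mathbb{E}}$, and $\mathbb{E}[[t]]$ the space of formal power series with coefficients in $\mathbb{E}$. For a direction $d\in\mathbb{R}$ and $\alpha,r>0$ put $S_d(\alpha)=\{\rho e^{i\phi}:\rho>0,\ \phi\in(d-\alpha/2,d+\alpha/2)\}$, $D_r=\{z\in\mathbb{C}:|z|<r\}$, and let $\hat S_d(\alpha,r)=S_d(\alpha)\cup D_r$ (a disc-sector in direction $d$, written $\hat S_d$ when $\alpha,r$ are not essential). For $\kappa>0$, $\mathcal{O}^{\kappa}(\hat S_d(\alpha,r),\mathbb{E})$ is the set of holomorphic $f:\hat S_d(\alpha,r)\to\mathbb{E}$ such that for all $\tilde\alpha\in(0,\alpha)$, $\tilde r\in(0,r)$ there are $A,B>0$ with $\|f(t)\|_{\mathbb{E}}<Ae^{B|t|^{\kappa}}$ for all $t\in\hat S_d(\tilde\alpha,\tilde r)$. For a power series, membership in this set means that it converges near $0$ and its sum extends analytically to such a function. For a sequence $m$ of positive numbers, the $m$-Borel operator $\mathcal{B}_m:\mathbb{E}[[t]]\to\mathbb{E}[[t]]$ is $\mathcal{B}_m(\sum_{n\ge0} b_nt^n)=\sum_{n\ge0}\frac{b_n}{m(n)}t^n$. Put $\Gamma_{1/\kappa}=(\Gamma(1+n/\kappa))_{n\ge0}$.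 A series $\hat u\in\mathbb{E}[[t]]$ is $\kappa$-summable in direction $d$ (written $\hat u\in\mathbb{E}\{t\}_{\kappa,d}$) if there is a disc-sector $\hat S_d$ in direction $d$ with $\mathcal{B}_{\Gamma_{1/\kappa}}\hat u\in\mathcal{O}^{\kappa}(\hat S_d,\mathbb{E})$. A sequence $m$ of positive numbers preserves summability if for every $\kappa>0$, $d\in\mathbb{R}$ and $\hat u\in\mathbb{E}[[t]]$: $\hat u\in\mathbb{E}\{t\}_{\kappa,d}$ if and only if $\mathcal{B}_m\hat u\in\mathbb{E}\{t\}_{\kappa,d}$. *)

theory Defs
  imports "HOL-Analysis.Analysis" "HOL-Computational_Algebra.Formal_Power_Series"
begin

class cbanach = banach +
  fixes scaleC :: "complex \<Rightarrow> 'a \<Rightarrow> 'a" (infixr "*\<^sub>C" 75)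
  assumes scaleR_scaleC: "scaleR r x = complex_of_real r *\<^sub>C x"
    and scaleC_add_right: "c *\<^sub>C (x + y) = c *\<^sub>C x + c *\<^sub>C y"
    and scaleC_add_left: "(b + c) *\<^sub>C x = b *\<^sub>C x + c *\<^sub>C x"
    and scaleC_scaleC: "b *\<^sub>C (c *\<^sub>C x) = (b * c) *\<^sub>C x"
    and scaleC_one: "1 *\<^sub>C x = x"
    and norm_scaleC: "norm (c *\<^sub>C x) = cmod c * norm x"

instantiation complex :: cbanach
begin

definition scaleC_complex :: "complex \<Rightarrow> complex \<Rightarrow> complex" where
  "scaleC_complex c z = c * z"

instance
  by standard (simp_all add: scaleC_complex_def algebra_simps scaleR_conv_of_real norm_mult)

end

text \<open>The library's \<open>holomorphic_on\<close> covers only functions with values in a field, hence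
  a Banach-space-valued version. The limit of the difference quotient is not restricted to the
  set, so this is meaningful for open sets; all sets used below are open.\<close>

definition cholomorphic_on :: "(complex \<Rightarrow> 'e::cbanach) \<Rightarrow> complex set \<Rightarrow> bool" where
  "cholomorphic_on f U \<longleftrightarrow>
     (\<forall>z\<in>U. \<exists>D. ((\<lambda>w. inverse (w - z) *\<^sub>C (f w - f z)) \<longlongrightarrow> D) (at z))"

lemma cholomorphic_on_complex_iff:
  fixes f :: "complex \<Rightarrow> complex"
  assumes "open U"
  shows "cholomorphic_on f U \<longleftrightarrow> f holomorphic_on U"
  using assms
  by (auto simp: cholomorphic_on_def holomorphic_on_open has_field_derivative_iff
      scaleC_complex_def field_simps)

definition sector :: "real \<Rightarrow> real \<Rightarrow> complex set" where
  "sector d \<alpha> =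
     {of_real \<rho> * cis \<phi> | \<rho> \<phi>. \<rho> > 0 \<and> \<phi> \<in> {d - \<alpha> / 2 <..< d + \<alpha> / 2}}"

definition disc_sector :: "real \<Rightarrow> real \<Rightarrow> real \<Rightarrow> complex set" where
  "disc_sector d \<alpha> r = sector d \<alpha> \<union> ball 0 r"

text \<open>Functions are total in HOL: only the values on \<open>disc_sector d \<alpha> r\<close> matter.\<close>

definition exp_growth_holo ::
  "real \<Rightarrow> real \<Rightarrow> real \<Rightarrow> real \<Rightarrow> (complex \<Rightarrow> 'e::cbanach) set" where
  "exp_growth_holo \<kappa> d \<alpha> r =
     {f. cholomorphic_on f (disc_sector d \<alpha> r) \<and>
         (\<forall>\<alpha>'\<in>{0<..<\<alpha>}. \<forall>r'\<in>{0<..<r}. \<exists>A>0. \<exists>B>0.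
            \<forall>t\<in>disc_sector d \<alpha>' r'. norm (f t) < A * exp (B * cmod t powr \<kappa>))}"

definition fps_in_exp_growth_holo ::
  "'e::cbanach fps \<Rightarrow> real \<Rightarrow> real \<Rightarrow> real \<Rightarrow> real \<Rightarrow> bool" where
  "fps_in_exp_growth_holo u \<kappa> d \<alpha> r \<longleftrightarrow>
     (\<exists>f\<in>exp_growth_holo \<kappa> d \<alpha> r.
        \<forall>\<^sub>F t in nhds 0. (\<lambda>n. t ^ n *\<^sub>C fps_nth u n) sums f t)"

definition borel_op :: "(nat \<Rightarrow> real) \<Rightarrow> 'e::cbanach fps \<Rightarrow> 'e fps" where
  "borel_op m u = Abs_fps (\<lambda>n. fps_nth u n /\<^sub>R m n)"

definition Gamma_seq :: "real \<Rightarrow> nat \<Rightarrow> real" where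
  "Gamma_seq s n = Gamma (1 + real n * s)"

definition summable_in_direction :: "real \<Rightarrow> real \<Rightarrow> 'e::cbanach fps \<Rightarrow> bool" where
  "summable_in_direction \<kappa> d u \<longleftrightarrow>
     (\<exists>\<alpha>>0. \<exists>r>0. fps_in_exp_growth_holo (borel_op (Gamma_seq (1 / \<kappa>)) u) \<kappa> d \<alpha> r)"

text \<open>The notion depends on the coefficient space, which is passed as a type argument.\<close>

definition preserves_summability :: "'e::cbanach itself \<Rightarrow> (nat \<Rightarrow> real) \<Rightarrow> bool" where
  "preserves_summability _ m \<longleftrightarrow>
     (\<forall>n. m n > 0) \<and>
     (\<forall>\<kappa>>0. \<forall>d. \<forall>u :: 'e fps.
        summable_in_direction \<kappa> d u \<longleftrightarrow> summable_in_direction \<kappa> d (borel_op m u))"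

end

theory Submission
  imports Defs
begin

text \<open>Put \<open>v = \<B>\<^bsub>\<Gamma>\<^esub> u\<close> and \<open>w = \<B>\<^bsub>m\<^esub> v\<close>, so that the sums are related by
  \<open>v(t) = \<Sum>i. w(a\<^sub>i t)\<close>. Growth and analyticity of \<open>w\<close> thus pass to \<open>v\<close> at once. Conversely,
  \<open>w(t) = v(t / a\<^sub>1) - (\<Sum>i\<ge>2. w(a\<^sub>i t / a\<^sub>1))\<close>, and all arguments of \<open>w\<close> on the right lie in the disc
  of radius \<open>q \<bar>t\<bar>\<close> for a fixed \<open>q < 1\<close>; iterating extends \<open>w\<close> from a disc to the whole
  disc-sector. The bound \<open>C exp (B \<bar>t\<bar>\<^sup>\<kappa>)\<close> is inherited by the extension if \<open>B\<close> is so large that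
  the gain \<open>exp (B (1 - q\<^sup>\<kappa>) \<bar>t\<bar>\<^sup>\<kappa>)\<close> outweighs the number of terms.\<close>

section \<open>Complex differentiability in Banach spaces\<close>

text \<open>The norm identity for complex scalars gives boundedness with constant 1, which makes the
  limit, continuity and series rules for bilinear maps available.\<close>

interpretation scaleC: bounded_bilinear "scaleC :: complex \<Rightarrow> 'a::cbanach \<Rightarrow> 'a"
proof
  fix r :: real and c c' :: complex and x y :: 'a
  show "(r *\<^sub>R c) *\<^sub>C x = r *\<^sub>R (c *\<^sub>C x)"
    unfolding scaleR_conv_of_real by (simp add: scaleR_scaleC scaleC_scaleC)
  show "c *\<^sub>C (r *\<^sub>R x) = r *\<^sub>R (c *\<^sub>C x)"
    by (simp add: scaleR_scaleC scaleC_scaleC mult.commute)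
  show "\<exists>K. \<forall>(a::complex) (b::'a). norm (a *\<^sub>C b) \<le> norm a * norm b * K"
    by (rule exI[of _ 1]) (simp add: norm_scaleC)
qed (simp_all add: scaleC_add_left scaleC_add_right)

text \<open>The pointwise form of \<open>cholomorphic_on\<close>: the extended function is later
  shown to be differentiable one point at a time, by induction on the modulus.\<close>

definition cdiff_at :: "(complex \<Rightarrow> 'e::cbanach) \<Rightarrow> complex \<Rightarrow> bool" where
  "cdiff_at f z \<longleftrightarrow> (\<exists>D. ((\<lambda>w. inverse (w - z) *\<^sub>C (f w - f z)) \<longlongrightarrow> D) (at z))"

lemma cholomorphic_on_cdiff_at: "cholomorphic_on f U \<longleftrightarrow> (\<forall>z\<in>U. cdiff_at f z)"
  by (simp add: cholomorphic_on_def cdiff_at_def)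

lemma cdiff_at_const: "cdiff_at (\<lambda>_. c) z"
  unfolding cdiff_at_def by (auto simp: scaleC.zero_right)

lemma cdiff_at_add:
  assumes "cdiff_at f z" "cdiff_at g z"
  shows "cdiff_at (\<lambda>t. f t + g t) z"
proof -
  obtain D E where "((\<lambda>w. inverse (w - z) *\<^sub>C (f w - f z)) \<longlongrightarrow> D) (at z)"
    "((\<lambda>w. inverse (w - z) *\<^sub>C (g w - g z)) \<longlongrightarrow> E) (at z)"
    using assms unfolding cdiff_at_def by blast
  from tendsto_add[OF this] show ?thesis
    unfolding cdiff_at_def scaleC_add_right[symmetric]
    by (intro exI[of _ "D + E"]) (simp add: algebra_simps)
qed

lemma cdiff_at_diff:
  assumes "cdiff_at f z" "cdiff_at g z"
  shows "cdiff_at (\<lambda>t. f t - g t) z"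
proof -
  obtain D E where "((\<lambda>w. inverse (w - z) *\<^sub>C (f w - f z)) \<longlongrightarrow> D) (at z)"
    "((\<lambda>w. inverse (w - z) *\<^sub>C (g w - g z)) \<longlongrightarrow> E) (at z)"
    using assms unfolding cdiff_at_def by blast
  from tendsto_diff[OF this] show ?thesis
    unfolding cdiff_at_def scaleC.diff_right[symmetric]
    by (intro exI[of _ "D - E"]) (simp add: algebra_simps)
qed

lemma cdiff_at_sum:
  assumes "\<And>i. i \<in> I \<Longrightarrow> cdiff_at (f i) z"
  shows "cdiff_at (\<lambda>t. \<Sum>i\<in>I. f i t) z"
  using assms by (induction I rule: infinite_finite_induct)
    (auto intro: cdiff_at_const cdiff_at_add)

text \<open>Since \<open>c\<close> is nonzero, multiplication by \<open>c\<close> carries punctured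
  neighbourhoods of \<open>z\<close> to punctured neighbourhoods of \<open>c * z\<close>; the
  difference quotient only picks up the factor \<open>c\<close>.\<close>

lemma cdiff_at_scale:
  assumes "cdiff_at f (c * z)" "c \<noteq> 0"
  shows "cdiff_at (\<lambda>t. f (c * t)) z"
proof -
  obtain D where D: "((\<lambda>w. inverse (w - c * z) *\<^sub>C (f w - f (c * z))) \<longlongrightarrow> D) (at (c * z))"
    using assms unfolding cdiff_at_def by blast
  have "filterlim (\<lambda>w. c * w) (at (c * z)) (at z)"
    unfolding filterlim_at using assms(2)
    by (auto simp: eventually_at_filter intro!: tendsto_eq_intros)
  from scaleC.tendsto[OF tendsto_const[of c] filterlim_compose[OF D this]]
  have "((\<lambda>w. (c * inverse (c * w - c * z)) *\<^sub>C (f (c * w) - f (c * z))) \<longlongrightarrow> c *\<^sub>C D) (at z)"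
    by (simp add: scaleC_scaleC)
  moreover have "c * inverse (c * w - c * z) = inverse (w - z)" for w
    using assms(2) by (simp add: right_diff_distrib[symmetric] divide_simps)
  ultimately show ?thesis
    unfolding cdiff_at_def by auto
qed

lemma cdiff_at_cong:
  assumes "open S" "z \<in> S" "\<And>t. t \<in> S \<Longrightarrow> f t = g t"
  shows "cdiff_at f z \<longleftrightarrow> cdiff_at g z"
proof -
  have "\<forall>\<^sub>F w in at z. inverse (w - z) *\<^sub>C (f w - f z) = inverse (w - z) *\<^sub>C (g w - g z)"
    using eventually_at_in_open'[OF assms(1,2)] by eventually_elim (use assms in auto)
  then show ?thesis
    unfolding cdiff_at_def by (simp add: tendsto_cong)
qed

section \<open>Power series with coefficients in a Banach space\<close>

text \<open>Bounds \<open>K / R ^ n\<close> on the coefficients stand in for a radius of convergence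
  of at least \<open>R\<close>. They yield a geometric majorant and pass easily from one series to
  another by comparing coefficients.\<close>

lemma norm_powser_term_le:
  fixes c :: "nat \<Rightarrow> 'e::cbanach"
  assumes "\<And>n. norm (c n) \<le> K / R ^ n" "cmod z \<le> s"
  shows "norm (z ^ n *\<^sub>C c n) \<le> K * (s / R) ^ n"
proof -
  have "0 \<le> s"
    using assms(2) norm_ge_zero[of z] by linarith
  then have "norm (z ^ n *\<^sub>C c n) \<le> s ^ n * (K / R ^ n)"
    unfolding norm_scaleC norm_power using assms
    by (intro mult_mono power_mono) auto
  then show ?thesis by (simp add: power_divide mult.commute)
qed

lemma summable_powser_bound:
  fixes c :: "nat \<Rightarrow> 'e::cbanach"
  assumes "\<And>n. norm (c n) \<le> K / R ^ n" "cmod z < R"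
  shows "summable (\<lambda>n. z ^ n *\<^sub>C c n)"
proof (rule summable_comparison_test')
  show "summable (\<lambda>n. K * (cmod z / R) ^ n)"
    using assms(2) by (intro summable_mult summable_geometric) (auto simp: abs_if divide_simps)
  show "norm (z ^ n *\<^sub>C c n) \<le> K * (cmod z / R) ^ n" for n
    using norm_powser_term_le[OF assms(1) order_refl] .
qed


lemma powser_norm_le:
  fixes c :: "nat \<Rightarrow> 'e::cbanach"
  assumes c: "\<And>n. norm (c n) \<le> K / R ^ n" and "s < R" "cmod z \<le> s"
  shows "norm (\<Sum>n. z ^ n *\<^sub>C c n) \<le> (\<Sum>n. K * (s / R) ^ n)"
proof -
  have s: "0 \<le> s"
    using assms(3) norm_ge_zero[of z] by linarith
  have summ: "summable (\<lambda>n. K * (s / R) ^ n)"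
    using assms(2) s by (intro summable_mult summable_geometric) (auto simp: abs_if divide_simps)
  have le: "norm (z ^ n *\<^sub>C c n) \<le> K * (s / R) ^ n" for n
    by (rule norm_powser_term_le[OF c assms(3)])
  have "summable (\<lambda>n. norm (z ^ n *\<^sub>C c n))"
    by (rule summable_comparison_test'[OF summ]) (use le in simp)
  then show ?thesis
    using order_trans[OF summable_norm suminf_le[OF le _ summ]] by blast
qed

text \<open>The difference quotient at \<open>z\<close> is itself a series of polynomials in
  \<open>w\<close>. It converges uniformly on a disc around 0 containing \<open>z\<close>, so its
  sum is continuous, and its value at \<open>z\<close> is the derivative.\<close>

lemma powser_cdiff_at:
  fixes c :: "nat \<Rightarrow> 'e::cbanach"
  assumes c: "\<And>n. norm (c n) \<le> K / R ^ n" and z: "cmod z < R"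
  shows "cdiff_at (\<lambda>t. \<Sum>n. t ^ n *\<^sub>C c n) z"
proof -
  define f where "f t = (\<Sum>n. t ^ n *\<^sub>C c n)" for t
  obtain s where s: "cmod z < s" "s < R"
    using z dense by blast
  have s0: "s > 0" "R > 0"
    using s norm_ge_zero[of z] by linarith+
  \<comment> \<open>This is the quotient of \<open>w ^ n - z ^ n\<close> by \<open>w - z\<close>,
    written as a polynomial so that it makes sense at \<open>w = z\<close> too.\<close>
  define p where "p n w = (\<Sum>i<n. z ^ (n - Suc i) * w ^ i)" for n w
  define g where "g w = (\<Sum>n. p n w *\<^sub>C c n)" for w
  have K: "K \<ge> 0"
    using c[of 0] by (auto intro: order_trans[OF norm_ge_zero])
  have bound: "norm (p n w *\<^sub>C c n) \<le> K / s * (of_nat (Suc n) * (s / R) ^ n)"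
    if w: "w \<in> ball 0 s" for n w
  proof -
    have "cmod (p n w) \<le> (\<Sum>i<n. s ^ (n - 1))"
      unfolding p_def
    proof (rule order_trans[OF norm_sum], rule sum_mono)
      fix i assume i: "i \<in> {..<n}"
      have "cmod (z ^ (n - Suc i) * w ^ i) \<le> s ^ (n - Suc i) * s ^ i"
        unfolding norm_mult norm_power using s w s0
        by (intro mult_mono power_mono) auto
      also have "\<dots> = s ^ (n - 1)"
        using i by (simp flip: power_add)
      finally show "cmod (z ^ (n - Suc i) * w ^ i) \<le> s ^ (n - 1)" .
    qed
    \<comment> \<open>For \<open>n = 0\<close> both sides vanish, so the truncated exponent
      \<open>n - 1\<close> does no harm.\<close>
    also have "\<dots> = of_nat n * s ^ n / s"
      using s0 by (cases n) auto
    \<comment> \<open>Enlarging \<open>n\<close> to \<open>Suc n\<close> produces the differentiated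
      geometric series, whose convergence is known.\<close>
    also have "\<dots> \<le> of_nat (Suc n) * s ^ n / s"
      using s0 by (intro divide_right_mono mult_right_mono) auto
    finally have "norm (p n w *\<^sub>C c n) \<le> (of_nat (Suc n) * s ^ n / s) * (K / R ^ n)"
      unfolding norm_scaleC using c[of n] s0 by (intro mult_mono) auto
    then show ?thesis by (simp add: power_divide field_simps)
  qed
  have summ: "summable (\<lambda>n. K / s * (of_nat (Suc n) * (s / R) ^ n))"
    using geometric_deriv_sums[of "s / R"] s s0
    by (intro summable_mult) (auto simp: sums_iff)
  have "uniform_limit (ball 0 s) (\<lambda>n w. \<Sum>i<n. p i w *\<^sub>C c i) g sequentially"
    unfolding g_def by (rule Weierstrass_m_test[OF bound summ])
  moreover have "\<forall>\<^sub>F n in sequentially. continuous_on (ball 0 s) (\<lambda>w. \<Sum>i<n. p i w *\<^sub>C c i)"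
    unfolding p_def by (intro always_eventually allI continuous_intros scaleC.continuous_on)
  ultimately have "continuous_on (ball 0 s) g"
    by (intro uniform_limit_theorem[where F = sequentially]) auto
  then have "g \<midarrow>z\<rightarrow> g z"
    using s by (simp add: continuous_on_eq_continuous_at isCont_def)
  moreover have "\<forall>\<^sub>F w in at z. g w = inverse (w - z) *\<^sub>C (f w - f z)"
  proof -
    have "\<forall>\<^sub>F w in at z. w \<in> ball 0 s - {z}"
      using s by (intro eventually_at_in_open) auto
    then show ?thesis
    proof eventually_elim
      case (elim w)
      have "(\<lambda>n. w ^ n *\<^sub>C c n - z ^ n *\<^sub>C c n) sums (f w - f z)"
        unfolding f_def using elim s z
        by (intro sums_diff summable_sums summable_powser_bound[OF c]) auto
      from bounded_linear.sums[OF scaleC.bounded_linear_right this]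
      have "(\<lambda>n. inverse (w - z) *\<^sub>C (w ^ n *\<^sub>C c n - z ^ n *\<^sub>C c n)) sums
          (inverse (w - z) *\<^sub>C (f w - f z))" .
      moreover have "inverse (w - z) *\<^sub>C (w ^ n *\<^sub>C c n - z ^ n *\<^sub>C c n) = p n w *\<^sub>C c n" for n
        using elim
        by (simp add: scaleC.diff_left[symmetric] scaleC_scaleC power_diff_sumr2 p_def
            flip: mult.assoc)
      ultimately show ?case
        unfolding g_def by (simp add: sums_iff)
    qed
  qed
  ultimately have "((\<lambda>w. inverse (w - z) *\<^sub>C (f w - f z)) \<longlongrightarrow> g z) (at z)"
    by (rule Lim_transform_eventually)
  then show ?thesis
    unfolding cdiff_at_def f_def by blast
qed

text \<open>Convergence at the single point \<open>R\<close> already bounds the terms of the series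
  there.\<close>

lemma powser_coeff_bound:
  fixes c :: "nat \<Rightarrow> 'e::cbanach"
  assumes "summable (\<lambda>n. of_real R ^ n *\<^sub>C c n)" "R > 0"
  obtains K where "\<And>n. norm (c n) \<le> K / R ^ n"
proof -
  obtain K where "\<And>n. norm (of_real R ^ n *\<^sub>C c n) \<le> K"
    using summable_imp_Bseq[OF assms(1)] by (auto simp: Bseq_def)
  then have "norm (c n) \<le> K / R ^ n" for n
    using assms(2) by (simp add: norm_scaleC norm_power field_simps)
  then show ?thesis by (rule that)
qed

text \<open>Dilating the argument by \<open>a\<close> multiplies the coefficients by
  \<open>a ^ n\<close>; this turns the power sums \<open>m n\<close> into sums of dilated
  functions.\<close>

lemma sums_scale:
  fixes c :: "nat \<Rightarrow> 'e::cbanach"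
  assumes "(\<lambda>n. (of_real a * t) ^ n *\<^sub>C c n) sums s"
  shows "(\<lambda>n. t ^ n *\<^sub>C (a ^ n *\<^sub>R c n)) sums s"
proof -
  have "(of_real a * t) ^ n *\<^sub>C c n = t ^ n *\<^sub>C (a ^ n *\<^sub>R c n)" for n
    by (simp add: power_mult_distrib scaleR_scaleC scaleC_scaleC mult.commute)
  with assms show ?thesis by simp
qed

section \<open>Disc-sectors\<close>

lemma sector_scale:
  assumes "t \<in> sector d \<alpha>" "c > 0"
  shows "of_real c * t \<in> sector d \<alpha>"
proof -
  obtain \<rho> \<phi> where "t = of_real \<rho> * cis \<phi>" "\<rho> > 0" "\<phi> \<in> {d - \<alpha> / 2 <..< d + \<alpha> / 2}"
    using assms unfolding sector_def by auto
  then show ?thesis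
    using assms(2) unfolding sector_def
    by (intro CollectI exI[of _ "c * \<rho>"] exI[of _ \<phi>]) auto
qed

text \<open>The sector is a cone, so only the disc restricts the scaling factor.\<close>

lemma disc_sector_scale:
  assumes "t \<in> disc_sector d \<alpha> r" "c > 0" "c * r \<le> r'"
  shows "of_real c * t \<in> disc_sector d \<alpha> r'"
proof (cases "t \<in> sector d \<alpha>")
  case True
  then show ?thesis using sector_scale[OF True assms(2)] by (simp add: disc_sector_def)
next
  case False
  then have "c * cmod t < c * r"
    using assms by (simp add: disc_sector_def)
  then have "c * cmod t < r'"
    using assms(3) by (rule less_le_trans)
  then show ?thesis
    using assms(2) by (simp add: disc_sector_def norm_mult)
qed

section \<open>Extension along the functional equation\<close>

text \<open>Induction on the number of contractions by \<open>q\<close> that bring \<open>t\<close>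
  into the disc of radius \<rho>; this number is finite because the powers of \<open>q\<close> tend
  to 0.\<close>

lemma contraction_induct:
  fixes q \<rho> :: real and t :: complex
  assumes "0 \<le> q" "q < 1" "0 < \<rho>"
    and base: "\<And>t. cmod t < \<rho> \<Longrightarrow> P t"
    and step: "\<And>t. \<rho> \<le> cmod t \<Longrightarrow> (\<And>s. cmod s \<le> q * cmod t \<Longrightarrow> P s) \<Longrightarrow> P t"
  shows "P t"
proof -
  have P: "P t" if "q ^ n * cmod t < \<rho>" for n t
    using that
  proof (induction n arbitrary: t)
    case 0
    then show ?case by (simp add: base)
  next
    case (Suc n)
    show ?case
    proof (cases "cmod t < \<rho>")
      case False
      show ?thesis
      proof (rule step)
        fix s assume "cmod s \<le> q * cmod t"
        then have "q ^ n * cmod s \<le> q ^ n * (q * cmod t)"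
          using assms by (intro mult_left_mono) auto
        then show "P s"
          using Suc.prems by (intro Suc.IH) (simp add: mult_ac)
      qed (use False in simp)
    qed (simp add: base)
  qed
  have "(\<lambda>n. q ^ n * cmod t) \<longlonglongrightarrow> 0 * cmod t"
    using assms by (intro tendsto_intros LIMSEQ_power_zero) auto
  then have "\<forall>\<^sub>F n in sequentially. q ^ n * cmod t < \<rho>"
    using assms by (intro order_tendstoD(2)[of _ 0]) auto
  then show ?thesis
    using P by (meson eventually_sequentially order_refl)
qed

lemma norm_contraction_le:
  "0 \<le> b \<Longrightarrow> b \<le> q \<Longrightarrow> cmod (of_real b * t) \<le> q * cmod t"
  by (simp add: norm_mult mult_right_mono)

text \<open>The equation is iterated, starting from \<open>W\<close>. If the iterates are stationary
  on the disc of radius \<open>q * cmod t\<close>, one more step makes them stationary on the disc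
  of radius \<open>cmod t\<close>. The limit solves the equation on the whole plane, whatever values
  \<open>h\<close> takes off its natural domain.\<close>

lemma functional_equation_extension:
  fixes h W :: "complex \<Rightarrow> 'e::ab_group_add" and b :: "'i \<Rightarrow> real"
  assumes q: "0 \<le> q" "q < 1" and \<rho>: "0 < \<rho>"
    and b: "\<And>i. i \<in> I \<Longrightarrow> 0 \<le> b i \<and> b i \<le> q"
    and W: "\<And>t. cmod t < \<rho> \<Longrightarrow> W t = h t - (\<Sum>i\<in>I. W (of_real (b i) * t))"
  obtains G where "\<And>t. G t = h t - (\<Sum>i\<in>I. G (of_real (b i) * t))"
    and "\<And>t. cmod t < \<rho> \<Longrightarrow> G t = W t"
proof -
  define F where "F = rec_nat W (\<lambda>_ G t. h t - (\<Sum>i\<in>I. G (of_real (b i) * t)))"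
  have F_0: "F 0 t = W t" and F_Suc: "F (Suc n) t = h t - (\<Sum>i\<in>I. F n (of_real (b i) * t))"
    for n t by (simp_all add: F_def)
  have F_small: "F n t = W t" if "cmod t < \<rho>" for n t
    using that
  proof (induction n arbitrary: t)
    case (Suc n)
    have "cmod (of_real (b i) * t) < \<rho>" if "i \<in> I" for i
    proof -
      have "cmod (of_real (b i) * t) \<le> q * cmod t"
        using b that by (intro norm_contraction_le) auto
      also have "\<dots> \<le> 1 * cmod t"
        using q by (intro mult_right_mono) auto
      finally show ?thesis using Suc.prems by simp
    qed
    then show ?case
      by (simp add: F_Suc Suc.IH W[OF Suc.prems])
  qed (simp add: F_0)
  \<comment> \<open>One index serves a whole disc, because the recursion evaluates the previous
    iterate at several points at once.\<close>
  have stab: "\<exists>N. \<forall>s. cmod s \<le> cmod t \<longrightarrow> (\<forall>n\<ge>N. F n s = F N s)" for t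
  proof (rule contraction_induct[OF q \<rho>,
        where P = "\<lambda>t. \<exists>N. \<forall>s. cmod s \<le> cmod t \<longrightarrow> (\<forall>n\<ge>N. F n s = F N s)"])
    fix t assume "cmod t < \<rho>"
    then show "\<exists>N. \<forall>s. cmod s \<le> cmod t \<longrightarrow> (\<forall>n\<ge>N. F n s = F N s)"
      by (intro exI[of _ 0]) (auto simp: F_small)
  next
    fix t
    assume IH: "\<And>s. cmod s \<le> q * cmod t \<Longrightarrow>
      \<exists>N. \<forall>x. cmod x \<le> cmod s \<longrightarrow> (\<forall>n\<ge>N. F n x = F N x)"
    \<comment> \<open>The point \<open>q * t\<close> has modulus exactly \<open>q * cmod t\<close>,
      so the induction hypothesis at this point covers the whole disc of that radius.\<close>
    have "cmod (of_real q * t) \<le> q * cmod t"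
      using q by (simp add: norm_mult)
    from IH[OF this] obtain N where
      N: "\<And>x n. cmod x \<le> q * cmod t \<Longrightarrow> n \<ge> N \<Longrightarrow> F n x = F N x"
      using q by (auto simp: norm_mult)
    have "F n s = F (Suc N) s" if "cmod s \<le> cmod t" "n \<ge> Suc N" for s n
    proof -
      obtain m where m: "n = Suc m" "m \<ge> N"
        using \<open>n \<ge> Suc N\<close> by (cases n) auto
      have "F m (of_real (b i) * s) = F N (of_real (b i) * s)" if "i \<in> I" for i
      proof (rule N)
        have "cmod (of_real (b i) * s) \<le> q * cmod s"
          using b that by (intro norm_contraction_le) auto
        also have "\<dots> \<le> q * cmod t"
          using q \<open>cmod s \<le> cmod t\<close> by (intro mult_left_mono) auto
        finally show "cmod (of_real (b i) * s) \<le> q * cmod t" .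
      qed (use m in simp)
      then show ?thesis by (simp add: m(1) F_Suc)
    qed
    then show "\<exists>N. \<forall>s. cmod s \<le> cmod t \<longrightarrow> (\<forall>n\<ge>N. F n s = F N s)"
      by blast
  qed
  then obtain N where N: "\<And>t s n. cmod s \<le> cmod t \<Longrightarrow> n \<ge> N t \<Longrightarrow> F n s = F (N t) s"
    by metis
  define G where "G t = F (N t) t" for t
  \<comment> \<open>Both \<open>N s\<close> and \<open>N t\<close> are stable indices at
    \<open>s\<close>; comparing them at their maximum shows that they give the same value.\<close>
  have G: "G s = F n s" if "cmod s \<le> cmod t" "n \<ge> N t" for s t n
    using N[OF that(1), of "max (N s) (N t)"] N[of s s "max (N s) (N t)"] N[OF that]
    by (simp add: G_def)
  show ?thesis
  proof (rule that[of G])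
    fix t
    have le: "cmod (of_real (b i) * t) \<le> cmod t" if "i \<in> I" for i
      using norm_contraction_le[of "b i" 1 t] b[OF that] q by simp
    \<comment> \<open>One index beyond \<open>N t\<close>, so that the recursion can be unfolded
      once.\<close>
    have "G t = F (Suc (N t)) t"
      by (rule G[of t t]) auto
    also have "\<dots> = h t - (\<Sum>i\<in>I. G (of_real (b i) * t))"
      unfolding F_Suc using G[OF le order_refl] by simp
    finally show "G t = h t - (\<Sum>i\<in>I. G (of_real (b i) * t))" .
  qed (simp add: G_def F_small)
qed

text \<open>Induction on the modulus with constants fixed in advance. Closure of \<open>S\<close>
  under the dilations keeps all arguments in the region where \<open>h\<close> is
  controlled.\<close>

lemma functional_equation_growth:
  fixes h G :: "complex \<Rightarrow> 'e::real_normed_vector" and b :: "'i \<Rightarrow> real"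
  assumes q: "0 \<le> q" "q < 1" and \<rho>: "0 < \<rho>" and \<kappa>: "0 < \<kappa>" and A: "0 < A" "0 < B"
    and b: "\<And>i. i \<in> I \<Longrightarrow> 0 \<le> b i \<and> b i \<le> q"
    and G: "\<And>t. G t = h t - (\<Sum>i\<in>I. G (of_real (b i) * t))"
    and S: "\<And>i t. i \<in> I \<Longrightarrow> t \<in> S \<Longrightarrow> of_real (b i) * t \<in> S"
    and small: "\<And>t. cmod t < \<rho> \<Longrightarrow> norm (G t) \<le> M"
    and h: "\<And>t. t \<in> S \<Longrightarrow> norm (h t) \<le> A * exp (B * cmod t powr \<kappa>)"
  obtains C B' where "C > 0" "B' > 0" "\<And>t. t \<in> S \<Longrightarrow> norm (G t) \<le> C * exp (B' * cmod t powr \<kappa>)"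
proof -
  define k where "k = real (card I)"
  define Q where "Q = q powr \<kappa>"
  have Q: "0 \<le> Q" "Q < 1"
    using q \<kappa> powr_less_mono2[of \<kappa> q 1] by (auto simp: Q_def)
  define L where "L = (1 - Q) * \<rho> powr \<kappa>"
  have L: "L > 0"
    using Q \<rho> by (simp add: L_def)
  \<comment> \<open>Here \<open>L\<close> is the least value of
    \<open>(1 - Q) * cmod t powr \<kappa>\<close> outside the disc of radius \<rho>, so
    \<open>B' * L\<close> is at least \<open>2 * k\<close>.\<close>
  define B' where "B' = max B (2 * k / L)"
  \<comment> \<open>The bound \<open>M\<close> settles the small disc; \<open>2 * A\<close> ensures
    that \<open>h\<close> uses up at most half of the final bound.\<close>
  define C where "C = max M (2 * A)"
  have B': "B' > 0" "B \<le> B'" and C: "C > 0" "M \<le> C" "A \<le> C / 2"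
    using A by (auto simp: B'_def C_def)
  have "t \<in> S \<longrightarrow> norm (G t) \<le> C * exp (B' * cmod t powr \<kappa>)" for t
  proof (rule contraction_induct[OF q \<rho>,
        where P = "\<lambda>t. t \<in> S \<longrightarrow> norm (G t) \<le> C * exp (B' * cmod t powr \<kappa>)"])
    fix t assume "cmod t < \<rho>"
    then have "norm (G t) \<le> C * 1"
      using small[of t] C by simp
    also have "\<dots> \<le> C * exp (B' * cmod t powr \<kappa>)"
      using C B' by (intro mult_left_mono) auto
    finally show "t \<in> S \<longrightarrow> norm (G t) \<le> C * exp (B' * cmod t powr \<kappa>)" by simp
  next
    fix t
    assume t: "\<rho> \<le> cmod t"
      and IH: "\<And>s. cmod s \<le> q * cmod t \<Longrightarrow> s \<in> S \<longrightarrow> norm (G s) \<le> C * exp (B' * cmod s powr \<kappa>)"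
    define T where "T = cmod t powr \<kappa>"
    have T: "\<rho> powr \<kappa> \<le> T" "T \<ge> 0"
      using t \<rho> \<kappa> by (auto simp: T_def intro: powr_mono2)
    show "t \<in> S \<longrightarrow> norm (G t) \<le> C * exp (B' * cmod t powr \<kappa>)"
    proof
      assume tS: "t \<in> S"
      have summand: "norm (G (of_real (b i) * t)) \<le> C * exp (B' * (Q * T))" if i: "i \<in> I" for i
      proof -
        have le: "cmod (of_real (b i) * t) \<le> q * cmod t"
          using b[OF i] by (intro norm_contraction_le) auto
        have "cmod (of_real (b i) * t) powr \<kappa> \<le> (q * cmod t) powr \<kappa>"
          using le \<kappa> by (intro powr_mono2) auto
        also have "\<dots> = Q * T"
          using q by (simp add: powr_mult Q_def T_def)
        finally have "C * exp (B' * cmod (of_real (b i) * t) powr \<kappa>) \<le> C * exp (B' * (Q * T))"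
          using C B' by simp
        with IH[OF le] S[OF i tS] show ?thesis by simp
      qed
      \<comment> \<open>Passing from \<open>Q * T\<close> to \<open>T\<close> in the exponent gains
        a factor of at least \<open>2 * k\<close>. This absorbs the \<open>k\<close> summands and
        leaves the other half of the bound to \<open>h\<close>.\<close>
      have "2 * k \<le> B' * L"
        using L by (simp add: B'_def max_def field_simps)
      also have "\<dots> \<le> B' * ((1 - Q) * T)"
        unfolding L_def using Q T B' by (intro mult_left_mono) auto
      also have "\<dots> \<le> exp (B' * ((1 - Q) * T))"
        using exp_ge_add_one_self[of "B' * ((1 - Q) * T)"] by linarith
      finally have "2 * k * exp (B' * (Q * T)) \<le> exp (B' * ((1 - Q) * T)) * exp (B' * (Q * T))"
        by (rule mult_right_mono) simp
      also have "\<dots> = exp (B' * T)"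
        by (simp add: algebra_simps flip: exp_add)
      finally have gain: "k * exp (B' * (Q * T)) \<le> exp (B' * T) / 2"
        by simp
      have "norm (G t) \<le> norm (h t) + norm (\<Sum>i\<in>I. G (of_real (b i) * t))"
        by (subst G) (rule norm_triangle_ineq4)
      also have "norm (\<Sum>i\<in>I. G (of_real (b i) * t)) \<le> k * (C * exp (B' * (Q * T)))"
        unfolding k_def using summand by (rule order_trans[OF norm_sum sum_bounded_above])
      also have "k * (C * exp (B' * (Q * T))) \<le> C * (exp (B' * T) / 2)"
        using mult_left_mono[OF gain, of C] C by (simp add: mult_ac)
      also have "norm (h t) \<le> C / 2 * exp (B' * T)"
      proof -
        have "norm (h t) \<le> A * exp (B * T)"
          using h[OF tS] by (simp add: T_def)
        also have "\<dots> \<le> C / 2 * exp (B' * T)"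
          using A C B' T by (intro mult_mono) (auto intro: mult_right_mono)
        finally show ?thesis .
      qed
      finally show "norm (G t) \<le> C * exp (B' * cmod t powr \<kappa>)"
        by (simp add: T_def)
    qed
  qed
  with B' C show ?thesis by (intro that[of C B']) auto
qed

section \<open>Passage between the two Borel transforms\<close>

text \<open>With the dominant factor \<open>c ^ n\<close> split off, the sum of \<open>v\<close> at
  \<open>t / c\<close> is the sum of \<open>w\<close> at \<open>t\<close> plus contracted copies of
  it. The extension and growth lemmas then apply, with the opening \<alpha> unchanged.\<close>

lemma fps_in_exp_growth_holo_descend:
  fixes v w :: "'e::cbanach fps" and b :: "'i \<Rightarrow> real"
  assumes q: "0 \<le> q" "q < 1" and b: "\<And>i. i \<in> I \<Longrightarrow> 0 < b i \<and> b i \<le> q"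
    and c: "0 < c" and \<kappa>: "0 < \<kappa>" and r: "0 < r"
    and v: "\<And>n. fps_nth v n = (c ^ n * (1 + (\<Sum>i\<in>I. b i ^ n))) *\<^sub>R fps_nth w n"
    and holo: "fps_in_exp_growth_holo v \<kappa> d \<alpha> r"
  shows "\<exists>\<rho>>0. fps_in_exp_growth_holo w \<kappa> d \<alpha> \<rho>"
proof -
  obtain f where f: "cholomorphic_on f (disc_sector d \<alpha> r)"
    and growth: "\<And>\<alpha>' r'. \<alpha>' \<in> {0<..<\<alpha>} \<Longrightarrow> r' \<in> {0<..<r} \<Longrightarrow> \<exists>A>0. \<exists>B>0.
            \<forall>t\<in>disc_sector d \<alpha>' r'. norm (f t) < A * exp (B * cmod t powr \<kappa>)"
    and sums: "\<forall>\<^sub>F t in nhds 0. (\<lambda>n. t ^ n *\<^sub>C fps_nth v n) sums f t"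
    using holo unfolding fps_in_exp_growth_holo_def exp_growth_holo_def by blast
  obtain \<delta> where \<delta>: "\<delta> > 0" and f_sums: "\<And>t. cmod t < \<delta> \<Longrightarrow> (\<lambda>n. t ^ n *\<^sub>C fps_nth v n) sums f t"
    using sums unfolding eventually_nhds_metric by auto
  \<comment> \<open>Below \<delta> the series of \<open>v\<close> converges at \<open>t0\<close>;
    below \<open>r\<close>, division by \<open>c\<close> takes the disc of radius
    \<open>c * t0\<close> into the domain of \<open>f\<close>.\<close>
  define t0 where "t0 = min \<delta> r / 2"
  have t0: "0 < t0" "t0 < \<delta>" "t0 < r"
    using \<delta> r by (auto simp: t0_def)
  have "summable (\<lambda>n. of_real t0 ^ n *\<^sub>C fps_nth v n)"
    using f_sums[of "of_real t0"] t0 by (auto simp: sums_iff)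
  then obtain K where K: "\<And>n. norm (fps_nth v n) \<le> K / t0 ^ n"
    using t0 powser_coeff_bound by blast
  define \<rho> where "\<rho> = c * t0"
  have \<rho>: "\<rho> > 0"
    using c t0 by (simp add: \<rho>_def)
  \<comment> \<open>The bracket relating \<open>v\<close> to \<open>w\<close> is at least 1, so
    \<open>c ^ n * norm (fps_nth w n)\<close> is at most \<open>norm (fps_nth v n)\<close>.\<close>
  have w_bound: "norm (fps_nth w n) \<le> K / \<rho> ^ n" for n
  proof -
    have "0 \<le> (\<Sum>i\<in>I. b i ^ n)"
      using b by (intro sum_nonneg) (auto simp: less_imp_le)
    then have "c ^ n * norm (fps_nth w n) * 1 \<le> c ^ n * norm (fps_nth w n) * (1 + (\<Sum>i\<in>I. b i ^ n))"
      using c by (intro mult_left_mono) auto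
    also have "\<dots> = norm (fps_nth v n)"
      using c \<open>0 \<le> (\<Sum>i\<in>I. b i ^ n)\<close> by (simp add: v abs_mult mult_ac)
    also have "\<dots> \<le> K / t0 ^ n" by (rule K)
    finally show ?thesis
      using c t0 by (simp add: \<rho>_def field_simps)
  qed
  define W where "W t = (\<Sum>n. t ^ n *\<^sub>C fps_nth w n)" for t
  have W_sums: "(\<lambda>n. t ^ n *\<^sub>C fps_nth w n) sums W t" if "cmod t < \<rho>" for t
    unfolding W_def by (rule summable_sums[OF summable_powser_bound[OF w_bound that]])
  define h where "h t = f (of_real (1 / c) * t)" for t
  have b1: "b i \<le> 1" if "i \<in> I" for i
    using b[OF that] q by simp
  have W_eq: "W t = h t - (\<Sum>i\<in>I. W (of_real (b i) * t))" if t: "cmod t < \<rho>" for t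
  proof -
    define s where "s = of_real (1 / c) * t"
    have ts: "t = of_real c * s" and "cmod s < t0"
      using t c by (auto simp: s_def \<rho>_def norm_mult norm_divide field_simps)
    have "cmod (of_real (b i) * t) < \<rho>" if "i \<in> I" for i
      using norm_contraction_le[of "b i" 1 t] b[OF that] b1[OF that] t by simp
    then have "(\<lambda>n. (of_real (b i * c) * s) ^ n *\<^sub>C fps_nth w n) sums W (of_real (b i) * t)"
      if "i \<in> I" for i
      using W_sums[of "of_real (b i) * t"] that by (simp add: ts mult.assoc)
    from sums_add[OF sums_scale[OF W_sums[OF t, unfolded ts]] sums_sum[OF sums_scale[OF this]]]
    have "(\<lambda>n. s ^ n *\<^sub>C (c ^ n *\<^sub>R fps_nth w n) +
        (\<Sum>i\<in>I. s ^ n *\<^sub>C ((b i * c) ^ n *\<^sub>R fps_nth w n))) sums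
        (W t + (\<Sum>i\<in>I. W (of_real (b i) * t)))"
      unfolding ts .
    also have "(\<lambda>n. s ^ n *\<^sub>C (c ^ n *\<^sub>R fps_nth w n) +
        (\<Sum>i\<in>I. s ^ n *\<^sub>C ((b i * c) ^ n *\<^sub>R fps_nth w n))) = (\<lambda>n. s ^ n *\<^sub>C fps_nth v n)"
      by (simp add: v scaleC.sum_right[symmetric] scaleC_add_right[symmetric]
          scaleR_sum_left[symmetric] scaleR_add_left[symmetric] distrib_left sum_distrib_left
          power_mult_distrib mult.commute)
    finally have "f s = W t + (\<Sum>i\<in>I. W (of_real (b i) * t))"
      using f_sums[of s] \<open>cmod s < t0\<close> t0 by (intro sums_unique2) auto
    then show ?thesis by (simp add: h_def s_def)
  qed
  have b0: "0 \<le> b i \<and> b i \<le> q" if "i \<in> I" for i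
    using b[OF that] by simp
  obtain G where G: "\<And>t. G t = h t - (\<Sum>i\<in>I. G (of_real (b i) * t))"
    and GW: "\<And>t. cmod t < \<rho> \<Longrightarrow> G t = W t"
    using functional_equation_extension[where h = h and W = W, OF q \<rho> b0 W_eq] by blast
  have sector: "of_real (b i) * t \<in> disc_sector d \<alpha>' r'"
    if "i \<in> I" "t \<in> disc_sector d \<alpha>' r'" "0 < r'" for i t \<alpha>' r'
    using that b b1 by (intro disc_sector_scale[of t d \<alpha>' r']) (auto simp: mult_le_cancel_right1)
  \<comment> \<open>On the small disc \<open>G\<close> is a power series. Further out, the
    functional equation expresses it through \<open>h\<close> and through \<open>G\<close> near
    points of smaller modulus that remain in the disc-sector.\<close>
  have "t \<in> disc_sector d \<alpha> \<rho> \<longrightarrow> cdiff_at G t" for t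
  proof (rule contraction_induct[OF q \<rho>, where P = "\<lambda>t. t \<in> disc_sector d \<alpha> \<rho> \<longrightarrow> cdiff_at G t"])
    fix t assume t: "cmod t < \<rho>"
    have "cdiff_at W t"
      unfolding W_def by (rule powser_cdiff_at[OF w_bound t])
    then show "t \<in> disc_sector d \<alpha> \<rho> \<longrightarrow> cdiff_at G t"
      using cdiff_at_cong[of "ball 0 \<rho>" t G W] t GW by simp
  next
    fix t
    assume IH: "\<And>s. cmod s \<le> q * cmod t \<Longrightarrow> s \<in> disc_sector d \<alpha> \<rho> \<longrightarrow> cdiff_at G s"
    show "t \<in> disc_sector d \<alpha> \<rho> \<longrightarrow> cdiff_at G t"
    proof
      assume t: "t \<in> disc_sector d \<alpha> \<rho>"
      have "of_real (1 / c) * t \<in> disc_sector d \<alpha> r"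
        using t c t0 by (intro disc_sector_scale[OF t]) (auto simp: \<rho>_def)
      then have "cdiff_at h t"
        unfolding h_def using f c by (intro cdiff_at_scale) (auto simp: cholomorphic_on_cdiff_at)
      moreover have "cdiff_at (\<lambda>t. G (of_real (b i) * t)) t" if i: "i \<in> I" for i
        using IH[OF norm_contraction_le] b[OF i] sector[OF i t \<rho>]
        by (intro cdiff_at_scale) auto
      ultimately have "cdiff_at (\<lambda>t. h t - (\<Sum>i\<in>I. G (of_real (b i) * t))) t"
        by (intro cdiff_at_diff cdiff_at_sum)
      \<comment> \<open>The equation holds at every point, so the differentiated function is
        \<open>G\<close> itself.\<close>
      then show "cdiff_at G t" by (simp flip: G)
    qed
  qed
  then have "cholomorphic_on G (disc_sector d \<alpha> \<rho>)"
    by (simp add: cholomorphic_on_cdiff_at)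
  moreover have "\<exists>A>0. \<exists>B>0. \<forall>t\<in>disc_sector d \<alpha>' r'. norm (G t) < A * exp (B * cmod t powr \<kappa>)"
    if \<alpha>': "\<alpha>' \<in> {0<..<\<alpha>}" and r': "r' \<in> {0<..<\<rho>}" for \<alpha>' r'
  proof -
    have "r' / c \<in> {0<..<r}"
      using r' c t0 by (auto simp: \<rho>_def field_simps intro: less_trans)
    then obtain A B where A: "A > 0" "B > 0"
      and fA: "\<And>t. t \<in> disc_sector d \<alpha>' (r' / c) \<Longrightarrow> norm (f t) < A * exp (B * cmod t powr \<kappa>)"
      using growth[OF \<alpha>'] by blast
    have hA: "norm (h t) \<le> A * exp (B / c powr \<kappa> * cmod t powr \<kappa>)"
      if t: "t \<in> disc_sector d \<alpha>' r'" for t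
    proof -
      have "of_real (1 / c) * t \<in> disc_sector d \<alpha>' (r' / c)"
        using c by (intro disc_sector_scale[OF t]) auto
      from fA[OF this] show ?thesis
        using c by (simp add: h_def norm_divide powr_divide)
    qed
    \<comment> \<open>As \<open>r'\<close> is less than \<rho>, the power series bounds
      \<open>G\<close> on the disc of radius \<open>r'\<close>, which then serves as the small disc
      of the growth estimate.\<close>
    obtain M where M: "\<And>t. cmod t < r' \<Longrightarrow> norm (G t) \<le> M"
    proof
      fix t assume "cmod t < r'"
      then show "norm (G t) \<le> (\<Sum>n. K * (r' / \<rho>) ^ n)"
        using r' powser_norm_le[of "fps_nth w", OF w_bound, of r' t] GW by (auto simp: W_def)
    qed
    have "0 < B / c powr \<kappa>" "0 < r'"
      using A c r' by auto
    with functional_equation_growth[where h = h and G = G and S = "disc_sector d \<alpha>' r'",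
        OF q _ \<kappa> A(1) _ b0 G sector M hA]
    obtain C B' where C: "C > 0" "B' > 0"
      "\<And>t. t \<in> disc_sector d \<alpha>' r' \<Longrightarrow> norm (G t) \<le> C * exp (B' * cmod t powr \<kappa>)"
      by blast
    \<comment> \<open>Adding 1 to \<open>C\<close> makes the inequality strict.\<close>
    have "norm (G t) < (C + 1) * exp (B' * cmod t powr \<kappa>)" if "t \<in> disc_sector d \<alpha>' r'" for t
      using C(3)[OF that] by (simp add: distrib_right add_strict_increasing2 le_less_trans)
    with C show ?thesis by (intro exI[of _ "C + 1"] conjI exI[of _ B']) auto
  qed
  moreover have "\<forall>\<^sub>F t in nhds 0. (\<lambda>n. t ^ n *\<^sub>C fps_nth w n) sums G t"
    unfolding eventually_nhds_metric using \<rho> W_sums GW by (intro exI[of _ \<rho>]) auto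
  ultimately have "fps_in_exp_growth_holo w \<kappa> d \<alpha> \<rho>"
    unfolding fps_in_exp_growth_holo_def exp_growth_holo_def by blast
  with \<rho> show ?thesis by blast
qed

text \<open>The sum of \<open>v\<close> is a finite sum of dilations of the sum of \<open>w\<close>.
  Factors of at most \<open>c\<close> map the disc of radius \<open>r / c\<close> into that of
  radius \<open>r\<close>, and the growth rate changes at most by
  \<open>c powr \<kappa>\<close>.\<close>

lemma fps_in_exp_growth_holo_ascend:
  fixes v w :: "'e::cbanach fps" and a :: "'i \<Rightarrow> real"
  assumes I: "finite I" "I \<noteq> {}" and a: "\<And>i. i \<in> I \<Longrightarrow> 0 < a i \<and> a i \<le> c"
    and c: "0 < c" and \<kappa>: "0 < \<kappa>" and r: "0 < r"
    and v: "\<And>n. fps_nth v n = (\<Sum>i\<in>I. a i ^ n) *\<^sub>R fps_nth w n"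
    and holo: "fps_in_exp_growth_holo w \<kappa> d \<alpha> r"
  shows "fps_in_exp_growth_holo v \<kappa> d \<alpha> (r / c)"
proof -
  obtain f where f: "cholomorphic_on f (disc_sector d \<alpha> r)"
    and growth: "\<And>\<alpha>' r'. \<alpha>' \<in> {0<..<\<alpha>} \<Longrightarrow> r' \<in> {0<..<r} \<Longrightarrow> \<exists>A>0. \<exists>B>0.
            \<forall>t\<in>disc_sector d \<alpha>' r'. norm (f t) < A * exp (B * cmod t powr \<kappa>)"
    and sums: "\<forall>\<^sub>F t in nhds 0. (\<lambda>n. t ^ n *\<^sub>C fps_nth w n) sums f t"
    using holo unfolding fps_in_exp_growth_holo_def exp_growth_holo_def by blast
  define g where "g t = (\<Sum>i\<in>I. f (of_real (a i) * t))" for t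
  have sector: "of_real (a i) * t \<in> disc_sector d \<alpha>' r'"
    if "i \<in> I" "t \<in> disc_sector d \<alpha>' (r' / c)" "0 < r'" for i t \<alpha>' r'
    using a[OF that(1)] c that by (intro disc_sector_scale[OF that(2)]) (auto simp: field_simps)
  have "cholomorphic_on g (disc_sector d \<alpha> (r / c))"
    unfolding cholomorphic_on_cdiff_at g_def
  proof (intro ballI cdiff_at_sum cdiff_at_scale)
    fix t i assume "t \<in> disc_sector d \<alpha> (r / c)" "i \<in> I"
    then show "cdiff_at f (of_real (a i) * t)"
      using f sector r by (auto simp: cholomorphic_on_cdiff_at)
    show "complex_of_real (a i) \<noteq> 0"
      using a[OF \<open>i \<in> I\<close>] by simp
  qed
  moreover have "\<exists>A>0. \<exists>B>0. \<forall>t\<in>disc_sector d \<alpha>' r'. norm (g t) < A * exp (B * cmod t powr \<kappa>)"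
    if \<alpha>': "\<alpha>' \<in> {0<..<\<alpha>}" and r': "r' \<in> {0<..<r / c}" for \<alpha>' r'
  proof -
    have cr': "c * r' \<in> {0<..<r}"
      using r' c by (auto simp: field_simps)
    from growth[OF \<alpha>' this] obtain A B where A: "A > 0" "B > 0"
      and fA: "\<And>t. t \<in> disc_sector d \<alpha>' (c * r') \<Longrightarrow> norm (f t) < A * exp (B * cmod t powr \<kappa>)"
      by blast
    have "norm (g t) < (card I * A) * exp (B * c powr \<kappa> * cmod t powr \<kappa>)"
      if t: "t \<in> disc_sector d \<alpha>' r'" for t
    proof -
      have "norm (f (of_real (a i) * t)) < A * exp (B * c powr \<kappa> * cmod t powr \<kappa>)" if i: "i \<in> I" for i
      proof -
        have "norm (f (of_real (a i) * t)) < A * exp (B * cmod (of_real (a i) * t) powr \<kappa>)"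
          using sector[OF i, of t \<alpha>' "c * r'"] t c cr' by (intro fA) auto
        also have "cmod (of_real (a i) * t) powr \<kappa> \<le> (c * cmod t) powr \<kappa>"
          using a[OF i] \<kappa> by (intro powr_mono2 norm_contraction_le) auto
        also have "\<dots> = c powr \<kappa> * cmod t powr \<kappa>"
          using c by (simp add: powr_mult)
        finally show ?thesis
          using A by (simp add: mult.assoc)
      qed
      then have "(\<Sum>i\<in>I. norm (f (of_real (a i) * t))) < (\<Sum>i\<in>I. A * exp (B * c powr \<kappa> * cmod t powr \<kappa>))"
        using I by (intro sum_strict_mono) auto
      then show ?thesis
        unfolding g_def by (intro le_less_trans[OF norm_sum]) simp
    qed
    moreover have "card I * A > 0" "B * c powr \<kappa> > 0"
      using A I c by (auto simp: card_gt_0_iff)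
    ultimately show ?thesis by blast
  qed
  moreover have "\<forall>\<^sub>F t in nhds 0. (\<lambda>n. t ^ n *\<^sub>C fps_nth v n) sums g t"
  proof -
    have "\<forall>\<^sub>F t in nhds 0. (\<lambda>n. (of_real (a i) * t) ^ n *\<^sub>C fps_nth w n) sums f (of_real (a i) * t)" for i
    proof -
      have "filterlim (\<lambda>t. of_real (a i) * t) (nhds 0) (nhds (0::complex))"
        by (rule tendsto_eq_rhs[OF tendsto_mult[OF tendsto_const filterlim_ident]]) simp
      from eventually_compose_filterlim[OF sums this] show ?thesis .
    qed
    then have "\<forall>\<^sub>F t in nhds 0. \<forall>i\<in>I.
        (\<lambda>n. (of_real (a i) * t) ^ n *\<^sub>C fps_nth w n) sums f (of_real (a i) * t)"
      using I by (simp add: eventually_ball_finite)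
    then show ?thesis
    proof eventually_elim
      case (elim t)
      then have "(\<lambda>n. \<Sum>i\<in>I. t ^ n *\<^sub>C (a i ^ n *\<^sub>R fps_nth w n)) sums g t"
        unfolding g_def by (intro sums_sum sums_scale) auto
      then show ?case
        by (simp add: v scaleR_sum_left scaleC.sum_right)
    qed
  qed
  ultimately show ?thesis
    unfolding fps_in_exp_growth_holo_def exp_growth_holo_def by blast
qed

theorem theorem9:
  fixes k :: nat and a :: "nat \<Rightarrow> real"
  assumes "k \<ge> 1"
    and "\<And>i j. 1 \<le> i \<Longrightarrow> i < j \<Longrightarrow> j \<le> k \<Longrightarrow> a i > a j"
    and "\<And>i. 1 \<le> i \<Longrightarrow> i \<le> k \<Longrightarrow> a i > 0"
  shows "preserves_summability TYPE('e::cbanach) (\<lambda>n. \<Sum>i=1..k. a i ^ n)"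
proof -
  define m where "m n = (\<Sum>i=1..k. a i ^ n)" for n
  have m_pos: "m n > 0" for n
    unfolding m_def using assms by (intro sum_pos) auto
  define c where "c = a 1"
  have c: "c > 0"
    using assms by (simp add: c_def)
  define b where "b i = a i / c" for i
  \<comment> \<open>Inserting 0 keeps the maximum meaningful when \<open>k = 1\<close>; strict
    decrease of the \<open>a i\<close> gives \<open>q < 1\<close>.\<close>
  define q where "q = Max (insert 0 (b ` {2..k}))"
  have b: "0 < b i \<and> b i \<le> q" if "i \<in> {2..k}" for i
    using assms(3)[of i] that c by (auto simp: b_def q_def intro!: Max_ge simp del: Max_insert)
  have q: "0 \<le> q" "q < 1"
    using assms(2)[of 1] c by (auto simp: q_def b_def c_def)
  have m_eq: "m n = c ^ n * (1 + (\<Sum>i\<in>{2..k}. b i ^ n))" for n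
  proof -
    have "c ^ n * b i ^ n = a i ^ n" for i
      using c by (simp add: b_def flip: power_mult_distrib)
    moreover have "m n = a 1 ^ n + (\<Sum>i\<in>{2..k}. a i ^ n)"
      unfolding m_def using sum.atLeast_Suc_atMost[OF assms(1)] by (simp add: numeral_2_eq_2)
    ultimately show ?thesis
      by (simp only: c_def[symmetric] distrib_left mult_1_right sum_distrib_left)
  qed
  have a_le: "0 < a i \<and> a i \<le> c" if "i \<in> {1..k}" for i
    using assms(2)[of 1 i] assms(3)[of i] that by (cases "i = 1") (auto simp: c_def)
  have "summable_in_direction \<kappa> d u \<longleftrightarrow> summable_in_direction \<kappa> d (borel_op m u)"
    if \<kappa>: "\<kappa> > 0" for \<kappa> d and u :: "'e fps"
  proof -
    define v where "v = borel_op (Gamma_seq (1 / \<kappa>)) u"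
    define w where "w = borel_op (Gamma_seq (1 / \<kappa>)) (borel_op m u)"
    \<comment> \<open>Both Borel operators act coefficientwise, so division by the Gamma values
      commutes with division by \<open>m n\<close>.\<close>
    have vw: "fps_nth v n = m n *\<^sub>R fps_nth w n" for n
      using m_pos[of n] by (simp add: v_def w_def borel_op_def)
    have descend: "\<exists>r'>0. fps_in_exp_growth_holo w \<kappa> d \<alpha> r'"
      if "r > 0" "fps_in_exp_growth_holo v \<kappa> d \<alpha> r" for \<alpha> r
      by (rule fps_in_exp_growth_holo_descend[OF q b c \<kappa> that(1) vw[unfolded m_eq] that(2)])
    have ascend: "fps_in_exp_growth_holo v \<kappa> d \<alpha> (r / c)"
      if "r > 0" "fps_in_exp_growth_holo w \<kappa> d \<alpha> r" for \<alpha> r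
      by (rule fps_in_exp_growth_holo_ascend[OF _ _ a_le c \<kappa> that(1) vw[unfolded m_def] that(2)])
        (use assms(1) in auto)
    show ?thesis
      unfolding summable_in_direction_def v_def[symmetric] w_def[symmetric]
    proof
      assume "\<exists>\<alpha>>0. \<exists>r>0. fps_in_exp_growth_holo v \<kappa> d \<alpha> r"
      then show "\<exists>\<alpha>>0. \<exists>r>0. fps_in_exp_growth_holo w \<kappa> d \<alpha> r"
        using descend by blast
    next
      assume "\<exists>\<alpha>>0. \<exists>r>0. fps_in_exp_growth_holo w \<kappa> d \<alpha> r"
      then obtain \<alpha> r where "\<alpha> > 0" "r > 0" "fps_in_exp_growth_holo w \<kappa> d \<alpha> r"
        by blast
      with ascend divide_pos_pos[OF \<open>r > 0\<close> c]
      show "\<exists>\<alpha>>0. \<exists>r>0. fps_in_exp_growth_holo v \<kappa> d \<alpha> r"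
        by blast
    qed
  qed
  then show ?thesis
    using m_pos unfolding preserves_summability_def m_def by blast
qed

end
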